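(* Let $p$ be a real number, let $F\subset\mathrm{Sym}^2(\mathbb{R}^n)$ be a cone subequation, and let $g\in C^2(S^{n-1})$ and $u(x)=\frac{1}{|x|^{p-2}}g\big(\frac{x}{|x|}\big)$ on $\mathbb{R}^n\setminus\{0\}$. Then $u$ is $F$-subharmonic on $\mathbb{R}^n\setminus\{0\}$ (i.e. $D^2_xu\in F$ for all $x\neq0$) if and only if $\Phi(J^2_\sigma g)\in F$ for all $\sigma\in S^{n-1}$; and $u$ is $F$-harmonic on $\mathbb{R}^n\setminus\{0\}$ (i.e. $D^2_xu\in\partial F$ for all $x\ne0$) if and only if $\Phi(J^2_\sigma g)\in\partial F$ for all $\sigma\in S^{n-1}$.
   Context: A cone subequation is a closed subset $F\subset\mathrm{Sym}^2(\mathbb{R}^n)$, $\emptyset\ne F\ne\mathrm{Sym}^2(\mathbb{R}^n)$, with $F+\mathcal{P}\subset F$ where $\mathcal{P}=\{A\ge0\}$, and $tF\subset F$ for all $t\ge0$. For $\sigma\in S^{n-1}$, $J^2_\sigma g=(g(\sigma),D_\sigma g,\mathrm{Hess}_\sigma g)$ is the Riemannian $2$-jet of $g$; using $\mathbb{R}^n=T_\sigma S^{n-1}\oplus\mathbb{R}\sigma$, the tangent vector $D_\sigma g$ is regarded as a vector in $\mathbb{R}^n$ and the quadratic form $\mathrm{Hess}_\sigma g$ is extended by zero on $\mathbb{R}\sigma$. Define $$\Phi(J^2_\sigma g)=\mathrm{Hess}_\sigma g-(p-2)g(\sigma)P_{\sigma^\perp}-(p-1)\big(\sigma\circ D_\sigma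 g\big)+(p-2)(p-1)g(\sigma)P_\sigma\in\mathrm{Sym}^2(\mathbb{R}^n),$$ where $P_\sigma,P_{\sigma^\perp}$ are orthogonal projections onto $\mathbb{R}\sigma$ and $\sigma^\perp$, and $\sigma\circ w=\sigma w^t+w\sigma^t$. Equivalently, in block form for $T_\sigma S^{n-1}\oplus\mathbb{R}\sigma$, $\Phi=\begin{pmatrix}\mathrm{Hess}\,g-(p-2)gI & -(p-1)Dg\\ -(p-1)Dg^t & (p-2)(p-1)g\end{pmatrix}$. *)

theory Defs
  imports "HOL-Analysis.Analysis"
begin

text \<open>Symmetric n x n real matrices, Sym^2(R^n), and the positive semidefinite cone P.\<close>
definition Sym :: "(real^'n^'n) set" where
  "Sym = {A. transpose A = A}"

definition PSD :: "(real^'n^'n) set" where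
  "PSD = {A \<in> Sym. \<forall>v. 0 \<le> v \<bullet> (A *v v)}"

definition cone_subequation :: "(real^'n^'n) set \<Rightarrow> bool" where
  "cone_subequation F \<longleftrightarrow> F \<subseteq> Sym \<and> closed F \<and> F \<noteq> {} \<and> F \<noteq> Sym \<and>
     (\<forall>A\<in>F. \<forall>P\<in>PSD. A + P \<in> F) \<and> (\<forall>A\<in>F. \<forall>t::real. t \<ge> 0 \<longrightarrow> t *\<^sub>R A \<in> F)"

text \<open>Boundary of F inside Sym^2(R^n).\<close>
definition bdry :: "(real^'n^'n) set \<Rightarrow> (real^'n^'n) set" where
  "bdry F = (top_of_set Sym) frontier_of F"

text \<open>Euclidean gradient and Hessian (via Frechet derivatives).\<close>
definition pd :: "(real^'n \<Rightarrow> real) \<Rightarrow> 'n \<Rightarrow> real^'n \<Rightarrow> real" where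
  "pd f j x = frechet_derivative f (at x) (axis j 1)"

definition grad :: "(real^'n \<Rightarrow> real) \<Rightarrow> real^'n \<Rightarrow> real^'n" where
  "grad f x = (\<chi> i. pd f i x)"

definition hess :: "(real^'n \<Rightarrow> real) \<Rightarrow> real^'n \<Rightarrow> real^'n^'n" where
  "hess f x = (\<chi> i j. pd (pd f j) i x)"

definition C1_on :: "(real^'n) set \<Rightarrow> (real^'n \<Rightarrow> real) \<Rightarrow> bool" where
  "C1_on U f \<longleftrightarrow> (\<forall>x\<in>U. f differentiable (at x)) \<and> (\<forall>j. continuous_on U (pd f j))"

definition C2_on :: "(real^'n) set \<Rightarrow> (real^'n \<Rightarrow> real) \<Rightarrow> bool" where
  "C2_on U f \<longleftrightarrow> C1_on U f \<and> (\<forall>j. C1_on U (pd f j))"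

text \<open>Functions on the unit sphere S^{n-1} are represented by functions on R^n, only their
 values on the sphere matter.  The 0-homogeneous extension:\<close>
definition sph_ext :: "(real^'n \<Rightarrow> real) \<Rightarrow> real^'n \<Rightarrow> real" where
  "sph_ext g x = g (x /\<^sub>R norm x)"

text \<open>g is in C^2(S^{n-1}) iff its 0-homogeneous extension is C^2 on R^n minus 0.\<close>
definition C2_sphere :: "(real^'n \<Rightarrow> real) \<Rightarrow> bool" where
  "C2_sphere g \<longleftrightarrow> C2_on (- {0}) (sph_ext g)"

definition outer :: "real^'n \<Rightarrow> real^'n \<Rightarrow> real^'n^'n" where
  "outer v w = (\<chi> i j. v $ i * w $ j)"

definition proj_line :: "real^'n \<Rightarrow> real^'n^'n" where
  "proj_line s = outer s s"

definition proj_perp :: "real^'n \<Rightarrow> real^'n^'n" where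
  "proj_perp s = mat 1 - outer s s"

text \<open>Riemannian gradient of g at s on the unit sphere, as a vector in R^n (tangential
 part of the Euclidean gradient of an extension).\<close>
definition sph_grad :: "(real^'n \<Rightarrow> real) \<Rightarrow> real^'n \<Rightarrow> real^'n" where
  "sph_grad g s = proj_perp s *v grad (sph_ext g) s"

text \<open>Riemannian Hessian of g at s on the unit sphere, as a quadratic form on R^n extended
 by zero on R s: for an extension G, Hess g (v,v) = D^2 G(v,v) - (grad G . s)|v|^2 for
 tangent v (Gauss formula for the unit sphere).\<close>
definition sph_hess :: "(real^'n \<Rightarrow> real) \<Rightarrow> real^'n \<Rightarrow> real^'n^'n" where
  "sph_hess g s = proj_perp s ** (hess (sph_ext g) s - (grad (sph_ext g) s \<bullet> s) *\<^sub>R mat 1)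
                   ** proj_perp s"

definition Phi :: "real \<Rightarrow> (real^'n \<Rightarrow> real) \<Rightarrow> real^'n \<Rightarrow> real^'n^'n" where
  "Phi p g s = sph_hess g s - ((p - 2) * g s) *\<^sub>R proj_perp s
     - (p - 1) *\<^sub>R (outer s (sph_grad g s) + outer (sph_grad g s) s)
     + ((p - 2) * (p - 1) * g s) *\<^sub>R proj_line s"

text \<open>u(x) = |x|^{-(p-2)} g(x/|x|).\<close>
definition homog_u :: "real \<Rightarrow> (real^'n \<Rightarrow> real) \<Rightarrow> real^'n \<Rightarrow> real" where
  "homog_u p g x = norm x powr (2 - p) * g (x /\<^sub>R norm x)"

end

theory Submission
  imports Defs
begin

text \<open>Write \<open>G\<close> for the 0-homogeneous extension of \<open>g\<close>, so that \<open>u(x) = |x|\<^sup>2\<^sup>-\<^sup>p G(x)\<close>.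
  Differentiating \<open>G(tx) = G(x)\<close> in \<open>t\<close> and in \<open>x\<close> gives the Euler identities \<open>x \<bullet> \<nabla>G(x) = 0\<close>
  and \<open>D\<^sup>2G(x) x = -\<nabla>G(x)\<close>, and shows that \<open>\<nabla>G\<close>, \<open>D\<^sup>2G\<close> are homogeneous of degree \<open>-1\<close>, \<open>-2\<close>.
  On the unit sphere these identities turn the tangential projections in the Riemannian
  gradient and Hessian into the full Euclidean ones, and the product rule then yields
  \<open>D\<^sup>2u(x) = |x|\<^sup>-\<^sup>p \<Phi>(J\<^sup>2g)(x/|x|)\<close>.  Since \<open>F\<close> and its boundary in \<open>Sym\<^sup>2(\<real>\<^sup>n)\<close> are invariant
  under multiplication by positive scalars, both equivalences follow.\<close>

lemma Sym_scaleR: "A \<in> Sym \<Longrightarrow> c *\<^sub>R A \<in> Sym"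
  by (simp add: Sym_def transpose_def vec_eq_iff)

lemma scaleR_mem_iff_of_positively_closed:
  fixes S :: "'a::real_vector set"
  assumes closed: "\<And>c A. c > 0 \<Longrightarrow> A \<in> S \<Longrightarrow> c *\<^sub>R A \<in> S" and "c > (0::real)"
  shows "c *\<^sub>R A \<in> S \<longleftrightarrow> A \<in> S"
proof
  assume "c *\<^sub>R A \<in> S"
  moreover have "inverse c *\<^sub>R (c *\<^sub>R A) = A"
    using \<open>c > 0\<close> by simp
  ultimately show "A \<in> S"
    using closed[of "inverse c"] \<open>c > 0\<close> by force
qed (use closed \<open>c > 0\<close> in simp)

lemma all_nonzero_iff_all_sphere_if_scale_invariant:
  fixes H :: "'a::real_normed_vector \<Rightarrow> 'b::real_vector"
  assumes H: "\<And>x. x \<noteq> 0 \<Longrightarrow> H x = c x *\<^sub>R K (x /\<^sub>R norm x)"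
    and c: "\<And>x. x \<noteq> 0 \<Longrightarrow> c x > 0"
    and S: "\<And>t A. t > 0 \<Longrightarrow> t *\<^sub>R A \<in> S \<longleftrightarrow> A \<in> S"
  shows "(\<forall>x. x \<noteq> 0 \<longrightarrow> H x \<in> S) \<longleftrightarrow> (\<forall>s\<in>sphere 0 1. K s \<in> S)"
proof
  assume "\<forall>x. x \<noteq> 0 \<longrightarrow> H x \<in> S"
  moreover have "s \<noteq> 0" "H s = c s *\<^sub>R K s" if "s \<in> sphere 0 1" for s
  proof -
    show "s \<noteq> 0"
      using that by auto
    then show "H s = c s *\<^sub>R K s"
      using that H[of s] by simp
  qed
  ultimately show "\<forall>s\<in>sphere 0 1. K s \<in> S"
    using S c by metis
next
  assume "\<forall>s\<in>sphere 0 1. K s \<in> S"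
  moreover have "x /\<^sub>R norm x \<in> sphere 0 1" if "x \<noteq> 0" for x
    using that by simp
  ultimately show "\<forall>x. x \<noteq> 0 \<longrightarrow> H x \<in> S"
    using S c H by metis
qed

lemma cone_subequation_scaleR_image:
  assumes "cone_subequation F" "c > 0"
  shows "(*\<^sub>R) c ` F = F"
proof -
  have mem_iff: "\<And>A. c *\<^sub>R A \<in> F \<longleftrightarrow> A \<in> F"
    using assms unfolding cone_subequation_def
    by (intro scaleR_mem_iff_of_positively_closed) auto
  have "A = c *\<^sub>R (inverse c *\<^sub>R A)" for A :: "real^'n^'n"
    using \<open>c > 0\<close> by simp
  then show ?thesis
    using mem_iff by (metis image_eqI subsetI subset_antisym image_subset_iff)
qed

lemma homeomorphic_map_scaleR_Sym:
  assumes "c \<noteq> (0::real)"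
  shows "homeomorphic_map (top_of_set Sym) (top_of_set (Sym::(real^'n^'n) set)) ((*\<^sub>R) c)"
proof -
  have "homeomorphic_maps (top_of_set Sym) (top_of_set (Sym::(real^'n^'n) set))
          ((*\<^sub>R) c) ((*\<^sub>R) (inverse c))"
    unfolding homeomorphic_maps_def using assms
    by (auto simp: continuous_map_subtopology_eu Sym_scaleR intro!: continuous_intros)
  then show ?thesis
    using homeomorphic_map_maps by blast
qed

lemma bdry_scaleR:
  assumes "cone_subequation F" "c > 0" "A \<in> bdry F"
  shows "c *\<^sub>R A \<in> bdry F"
proof -
  have "F \<subseteq> topspace (top_of_set Sym)"
    using assms(1) unfolding cone_subequation_def by auto
  then have "(*\<^sub>R) c ` bdry F = (top_of_set Sym) frontier_of ((*\<^sub>R) c ` F)"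
    unfolding bdry_def using \<open>c > 0\<close>
    by (intro homeomorphic_map_frontier_of[symmetric] homeomorphic_map_scaleR_Sym) auto
  also have "\<dots> = bdry F"
    unfolding bdry_def using cone_subequation_scaleR_image[OF assms(1,2)] by simp
  finally show ?thesis
    using assms(3) by blast
qed

lemma pd_eq_if_has_derivative: "(f has_derivative D) (at x) \<Longrightarrow> pd f j x = D (axis j 1)"
  unfolding pd_def using frechet_derivative_at by metis

lemma linear_eq_sum_axis:
  assumes "linear (D :: real^'n \<Rightarrow> real)"
  shows "D h = (\<Sum>j\<in>UNIV. h$j * D (axis j 1))"
proof -
  have "D h = D (\<Sum>j\<in>UNIV. h$j *\<^sub>R axis j 1)"
    using basis_expansion[of h] by (simp add: scalar_mult_eq_scaleR)
  also have "\<dots> = (\<Sum>j\<in>UNIV. h$j * D (axis j 1))"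
    using assms by (simp add: linear_sum linear_cmul)
  finally show ?thesis .
qed

lemma has_derivative_pd_sum:
  assumes "f differentiable (at x)"
  shows "(f has_derivative (\<lambda>h. \<Sum>j\<in>UNIV. h$j * pd f j x)) (at x)"
proof -
  have D: "(f has_derivative frechet_derivative f (at x)) (at x)"
    using assms frechet_derivative_works by blast
  then have "frechet_derivative f (at x) = (\<lambda>h. \<Sum>j\<in>UNIV. h$j * pd f j x)"
    unfolding pd_def using linear_eq_sum_axis has_derivative_linear by blast
  then show ?thesis
    using D by simp
qed

lemma sum_axis_mult [simp]: "(\<Sum>k\<in>UNIV. (c *\<^sub>R axis i (1::real))$k * f k) = c * f i"
proof -
  have "\<And>k. (c *\<^sub>R axis i (1::real))$k * f k = (if i = k then c * f k else 0)"
    by (simp add: axis_def)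
  then show ?thesis
    by simp
qed

lemma sum_axis_mult_one [simp]: "(\<Sum>k\<in>UNIV. (axis i (1::real))$k * f k) = f i"
  using sum_axis_mult[of 1] by simp

lemma has_derivative_norm_powr:
  fixes x :: "real^'n"
  assumes "x \<noteq> 0"
  shows "((\<lambda>y. norm y powr a) has_derivative (\<lambda>h. a * norm x powr (a-2) * (x \<bullet> h))) (at x)"
proof -
  have n: "norm x > 0"
    using assms by simp
  have "((\<lambda>y. norm y powr a) has_derivative (\<lambda>h. (a * norm x powr (a-1)) * (h \<bullet> sgn x))) (at x)"
    using has_derivative_compose[OF has_derivative_norm[OF assms]
        has_field_derivative_imp_has_derivative[OF has_real_derivative_powr[OF n]]]
    by (simp add: mult.commute)
  moreover have "norm x powr (a-1) = norm x powr (a-2) * norm x"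
    using powr_add[of "norm x" "a-2" 1] n by simp
  then have "(\<lambda>h. (a * norm x powr (a-1)) * (h \<bullet> sgn x)) = (\<lambda>h. a * norm x powr (a-2) * (x \<bullet> h))"
    using n by (simp add: sgn_div_norm inner_commute fun_eq_iff field_simps)
  ultimately show ?thesis
    by simp
qed

lemma pd_scaleR_of_homogeneous:
  fixes f :: "real^'n \<Rightarrow> real"
  assumes "t > 0" and hom: "\<And>y. y \<noteq> 0 \<Longrightarrow> f (t *\<^sub>R y) = c * f y" and "x \<noteq> 0"
    and "f differentiable (at x)" "f differentiable (at (t *\<^sub>R x))"
  shows "t * pd f j (t *\<^sub>R x) = c * pd f j x"
proof -
  have "((\<lambda>y. f (t *\<^sub>R y)) has_derivative
          (\<lambda>h. \<Sum>k\<in>UNIV. (t *\<^sub>R h)$k * pd f k (t *\<^sub>R x))) (at x)"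
    by (rule has_derivative_compose[where f="\<lambda>y. t *\<^sub>R y", OF _ has_derivative_pd_sum])
       (auto intro!: derivative_eq_intros assms(5))
  then have "((\<lambda>y. c * f y) has_derivative
          (\<lambda>h. \<Sum>k\<in>UNIV. (t *\<^sub>R h)$k * pd f k (t *\<^sub>R x))) (at x)"
    by (rule has_derivative_transform_within_open[where s="- {0}"]) (use assms in auto)
  moreover have "((\<lambda>y. c * f y) has_derivative (\<lambda>h. c * (\<Sum>k\<in>UNIV. h$k * pd f k x))) (at x)"
    by (intro has_derivative_mult_right has_derivative_pd_sum assms(4))
  ultimately have "(\<lambda>h. \<Sum>k\<in>UNIV. (t *\<^sub>R h)$k * pd f k (t *\<^sub>R x))
                 = (\<lambda>h. c * (\<Sum>k\<in>UNIV. h$k * pd f k x))"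
    by (rule has_derivative_unique)
  from fun_cong[OF this, of "axis j 1"] show ?thesis
    by (simp del: vector_scaleR_component)
qed

lemma euler_homogeneous:
  fixes f :: "real^'n \<Rightarrow> real"
  assumes hom: "\<And>t. t > 0 \<Longrightarrow> f (t *\<^sub>R x) = t powr k * f x" and "f differentiable (at x)"
  shows "(\<Sum>j\<in>UNIV. x$j * pd f j x) = k * f x"
proof -
  have "((\<lambda>r. f (r *\<^sub>R x)) has_derivative (\<lambda>h. \<Sum>j\<in>UNIV. (h *\<^sub>R x)$j * pd f j x)) (at 1)"
  proof (rule has_derivative_compose[of "\<lambda>r. r *\<^sub>R x"])
    show "((\<lambda>r. r *\<^sub>R x) has_derivative (\<lambda>h. h *\<^sub>R x)) (at 1)"
      by (auto intro!: derivative_eq_intros)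
    show "(f has_derivative (\<lambda>h. \<Sum>j\<in>UNIV. h$j * pd f j x)) (at (1 *\<^sub>R x))"
      using has_derivative_pd_sum[OF assms(2)] by simp
  qed
  moreover have "((\<lambda>r. f (r *\<^sub>R x)) has_derivative (\<lambda>h. (k * f x) * h)) (at 1)"
  proof (rule has_derivative_transform_within_open[where s="{0<..}"])
    have "((\<lambda>r. r powr k * f x) has_real_derivative k * f x) (at 1)"
      by (auto intro!: derivative_eq_intros)
    then show "((\<lambda>r. r powr k * f x) has_derivative (\<lambda>h. (k * f x) * h)) (at 1)"
      by (rule has_field_derivative_imp_has_derivative)
  qed (auto simp: hom)
  ultimately have "(\<lambda>h. \<Sum>j\<in>UNIV. (h *\<^sub>R x)$j * pd f j x) = (\<lambda>h. (k * f x) * h)"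
    by (rule has_derivative_unique)
  from fun_cong[OF this, of 1] show ?thesis
    by simp
qed

locale zero_homogeneous_C2 =
  fixes G :: "real^'n \<Rightarrow> real"
  assumes homogeneous: "t > 0 \<Longrightarrow> G (t *\<^sub>R x) = G x"
    and C2: "C2_on (- {0}) G"
begin

lemma differentiable_G: "x \<noteq> 0 \<Longrightarrow> G differentiable (at x)"
  and differentiable_pd_G: "x \<noteq> 0 \<Longrightarrow> pd G j differentiable (at x)"
  using C2 unfolding C2_on_def C1_on_def by auto

lemma has_derivative_G: "x \<noteq> 0 \<Longrightarrow> (G has_derivative (\<lambda>h. \<Sum>j\<in>UNIV. h$j * pd G j x)) (at x)"
  by (intro has_derivative_pd_sum differentiable_G)

lemma has_derivative_pd_G:
  "x \<noteq> 0 \<Longrightarrow> (pd G j has_derivative (\<lambda>h. \<Sum>i\<in>UNIV. h$i * pd (pd G j) i x)) (at x)"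
  by (intro has_derivative_pd_sum differentiable_pd_G)

lemma pd_G_scaleR:
  assumes "t > 0" "x \<noteq> 0"
  shows "pd G j (t *\<^sub>R x) = pd G j x / t"
  using pd_scaleR_of_homogeneous[of t G 1 x j] assms
  by (simp add: homogeneous differentiable_G field_simps)

lemma pd_pd_G_scaleR:
  assumes "t > 0" "x \<noteq> 0"
  shows "pd (pd G j) i (t *\<^sub>R x) = pd (pd G j) i x / t\<^sup>2"
  using pd_scaleR_of_homogeneous[of t "pd G j" "inverse t" x i] assms
  by (simp add: pd_G_scaleR differentiable_pd_G field_simps power2_eq_square)

lemma euler_G: "x \<noteq> 0 \<Longrightarrow> (\<Sum>j\<in>UNIV. x$j * pd G j x) = 0"
  using euler_homogeneous[of G x 0] by (simp add: homogeneous differentiable_G)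

lemma euler_pd_G: "x \<noteq> 0 \<Longrightarrow> (\<Sum>i\<in>UNIV. x$i * pd (pd G j) i x) = - pd G j x"
  using euler_homogeneous[of "pd G j" x "-1"]
  by (simp add: pd_G_scaleR differentiable_pd_G powr_minus_divide)

text \<open>Obtained by differentiating \<open>x \<bullet> \<nabla>G(x) = 0\<close> in \<open>x\<close>, which avoids appealing to the
  symmetry of second derivatives.\<close>
lemma euler_pd_G_transpose: "x \<noteq> 0 \<Longrightarrow> (\<Sum>j\<in>UNIV. x$j * pd (pd G j) i x) = - pd G i x"
proof -
  assume x: "x \<noteq> 0"
  have "((\<lambda>y. \<Sum>j\<in>UNIV. y$j * pd G j y) has_derivative
     (\<lambda>h. \<Sum>j\<in>UNIV. x$j * (\<Sum>i\<in>UNIV. h$i * pd (pd G j) i x) + h$j * pd G j x)) (at x)"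
    by (intro has_derivative_sum has_derivative_mult has_derivative_pd_G[OF x] has_derivative_ident
        bounded_linear.has_derivative[OF bounded_linear_vec_nth])
  moreover have "((\<lambda>y. \<Sum>j\<in>UNIV. y$j * pd G j y) has_derivative (\<lambda>h. 0)) (at x)"
    by (rule has_derivative_transform_within_open[OF has_derivative_const[of 0], where s="- {0}"])
       (use x euler_G in auto)
  ultimately have "(\<lambda>h. \<Sum>j\<in>UNIV. x$j * (\<Sum>i\<in>UNIV. h$i * pd (pd G j) i x) + h$j * pd G j x)
                 = (\<lambda>h. 0)"
    by (rule has_derivative_unique)
  from fun_cong[OF this, of "axis i 1"] show ?thesis
    by (simp add: sum.distrib eq_neg_iff_add_eq_0)
qed

lemma pd_radial_mult:
  assumes "x \<noteq> 0"
  shows "pd (\<lambda>y. norm y powr a * G y) j x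
       = norm x powr a * pd G j x + a * norm x powr (a-2) * x$j * G x"
proof -
  have "((\<lambda>y. norm y powr a * G y) has_derivative (\<lambda>h. norm x powr a * (\<Sum>j\<in>UNIV. h$j * pd G j x)
          + (a * norm x powr (a-2) * (x \<bullet> h)) * G x)) (at x)"
    by (intro has_derivative_mult has_derivative_norm_powr has_derivative_G assms)
  from pd_eq_if_has_derivative[OF this, of j] show ?thesis
    by (simp add: inner_axis)
qed

lemma pd_pd_radial_mult:
  assumes x: "x \<noteq> 0"
  shows "pd (pd (\<lambda>y. norm y powr a * G y) j) i x = norm x powr a * pd (pd G j) i x
     + (a * norm x powr (a-2) * x$i) * pd G j x
     + a * (norm x powr (a-2) * (x$j * pd G i x + (if i = j then 1 else 0) * G x)
          + ((a-2) * norm x powr (a-2-2) * x$i) * (x$j * G x))"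
proof -
  let ?W = "\<lambda>y. norm y powr a * pd G j y + a * (norm y powr (a-2) * (y$j * G y))"
  have "(?W has_derivative (\<lambda>h. norm x powr a * (\<Sum>i\<in>UNIV. h$i * pd (pd G j) i x)
          + (a * norm x powr (a-2) * (x \<bullet> h)) * pd G j x
          + a * (norm x powr (a-2) * (x$j * (\<Sum>i\<in>UNIV. h$i * pd G i x) + h$j * G x)
          + ((a-2) * norm x powr (a-2-2) * (x \<bullet> h)) * (x$j * G x)))) (at x)"
    by (intro has_derivative_add has_derivative_mult has_derivative_norm_powr has_derivative_G
        has_derivative_pd_G x has_derivative_mult_right has_derivative_ident
        bounded_linear.has_derivative[OF bounded_linear_vec_nth])
  then have "(pd (\<lambda>y. norm y powr a * G y) j has_derivative (\<lambda>h. norm x powr a * (\<Sum>i\<in>UNIV. h$i * pd (pd G j) i x)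
          + (a * norm x powr (a-2) * (x \<bullet> h)) * pd G j x
          + a * (norm x powr (a-2) * (x$j * (\<Sum>i\<in>UNIV. h$i * pd G i x) + h$j * G x)
          + ((a-2) * norm x powr (a-2-2) * (x \<bullet> h)) * (x$j * G x)))) (at x)"
    by (rule has_derivative_transform_within_open[where s="- {0}"])
       (use x pd_radial_mult in \<open>auto simp: algebra_simps\<close>)
  from pd_eq_if_has_derivative[OF this, of i] show ?thesis
    by (simp only: sum_axis_mult_one inner_axis) (simp add: axis_def)
qed

end

lemma proj_perp_matrix_mult_nth:
  "(proj_perp s ** A)$i$j = A$i$j - s$i * (\<Sum>k\<in>UNIV. s$k * A$k$j)"
proof -
  have "(proj_perp s ** A)$i$j = (\<Sum>k\<in>UNIV. (if i = k then A$k$j else 0) - s$i * (s$k * A$k$j))"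
    by (auto simp: proj_perp_def matrix_matrix_mult_def mat_def outer_def algebra_simps
        intro!: sum.cong)
  also have "\<dots> = A$i$j - s$i * (\<Sum>k\<in>UNIV. s$k * A$k$j)"
    by (simp add: sum_subtractf sum_distrib_left)
  finally show ?thesis .
qed

lemma matrix_mult_proj_perp_nth:
  "(A ** proj_perp s)$i$j = A$i$j - (\<Sum>k\<in>UNIV. A$i$k * s$k) * s$j"
proof -
  have "(A ** proj_perp s)$i$j = (\<Sum>k\<in>UNIV. (if k = j then A$i$k else 0) - (A$i$k * s$k) * s$j)"
    by (auto simp: proj_perp_def matrix_matrix_mult_def mat_def outer_def algebra_simps
        intro!: sum.cong)
  also have "\<dots> = A$i$j - (\<Sum>k\<in>UNIV. A$i$k * s$k) * s$j"
    by (simp add: sum_subtractf sum_distrib_right)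
  finally show ?thesis .
qed

lemma zero_homogeneous_C2_sph_ext:
  fixes g :: "real^'n \<Rightarrow> real"
  assumes "C2_sphere g"
  shows "zero_homogeneous_C2 (sph_ext g)"
proof
  show "sph_ext g (t *\<^sub>R x) = sph_ext g x" if "t > 0" for t and x :: "real^'n"
    using that by (cases "x = 0") (auto simp: sph_ext_def field_simps)
qed (use assms in \<open>simp add: C2_sphere_def\<close>)

context
  fixes g :: "real^'n \<Rightarrow> real"
  assumes C2: "C2_sphere g"
begin

abbreviation "G \<equiv> sph_ext g"

interpretation G: zero_homogeneous_C2 G
  by (rule zero_homogeneous_C2_sph_ext[OF C2])

lemma sph_grad_eq_grad:
  assumes "norm s = 1"
  shows "sph_grad g s = grad G s"
proof -
  have "(\<Sum>k\<in>UNIV. s$k * pd G k s) = 0"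
    using assms by (auto intro: G.euler_G)
  then have "(\<Sum>k\<in>UNIV. (if i = k then pd G k s else 0) - s$i * (s$k * pd G k s)) = pd G i s" for i
    by (simp add: sum_subtractf sum_distrib_left[symmetric])
  moreover have "(proj_perp s *v grad G s)$i
      = (\<Sum>k\<in>UNIV. (if i = k then pd G k s else 0) - s$i * (s$k * pd G k s))" for i
    unfolding proj_perp_def matrix_vector_mult_def grad_def mat_def outer_def
    by (simp, intro sum.cong) (auto simp: algebra_simps)
  ultimately show ?thesis
    by (simp add: sph_grad_def vec_eq_iff grad_def)
qed

lemma sph_hess_nth:
  assumes "norm s = 1"
  shows "sph_hess g s $i$j = pd (pd G j) i s + s$i * pd G j s + pd G i s * s$j"
proof -
  have s: "s \<noteq> 0"
    using assms by auto
  have "grad G s \<bullet> s = 0"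
    using G.euler_G[OF s] by (simp add: inner_vec_def grad_def mult.commute)
  then have "sph_hess g s = proj_perp s ** hess G s ** proj_perp s"
    by (simp add: sph_hess_def)
  moreover have PH: "(proj_perp s ** hess G s)$i$k = pd (pd G k) i s + s$i * pd G k s" for i k
    using G.euler_pd_G[OF s] by (simp add: proj_perp_matrix_mult_nth hess_def)
  moreover have "(\<Sum>k\<in>UNIV. (proj_perp s ** hess G s)$i$k * s$k)
      = (\<Sum>k\<in>UNIV. s$k * pd (pd G k) i s) + s$i * (\<Sum>k\<in>UNIV. s$k * pd G k s)"
    by (simp add: PH algebra_simps sum.distrib sum_distrib_left)
  then have "(\<Sum>k\<in>UNIV. (proj_perp s ** hess G s)$i$k * s$k) = - pd G i s"
    using G.euler_G[OF s] G.euler_pd_G_transpose[OF s] by simp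
  ultimately show ?thesis
    by (simp add: matrix_mult_proj_perp_nth)
qed

lemma Phi_nth:
  assumes "norm s = 1"
  shows "Phi p g s $i$j = pd (pd G j) i s + (2-p) * (s$i * pd G j s + pd G i s * s$j)
     + (2-p) * (if i = j then 1 else 0) * G s + (2-p) * (-p) * (s$i * s$j) * G s"
proof -
  have "G s = g s"
    using assms by (simp add: sph_ext_def)
  then show ?thesis
    unfolding Phi_def
    by (simp add: sph_hess_nth sph_grad_eq_grad assms proj_perp_def proj_line_def outer_def
        mat_def grad_def)
       (simp add: algebra_simps)
qed

lemma hess_homog_u:
  assumes x: "x \<noteq> 0"
  shows "hess (homog_u p g) x = norm x powr (-p) *\<^sub>R Phi p g (x /\<^sub>R norm x)"
proof -
  define n where "n = norm x"
  define s where "s = x /\<^sub>R n"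
  have n: "n > 0"
    using x by (simp add: n_def)
  have s1: "norm s = 1" and s: "s \<noteq> 0"
    using x by (auto simp: s_def n_def)
  have xs: "x = n *\<^sub>R s"
    using n by (simp add: s_def)
  have u: "homog_u p g = (\<lambda>y. norm y powr (2-p) * G y)"
    by (simp add: homog_u_def sph_ext_def fun_eq_iff)
  have powr: "n powr (2-p) = n powr (-p) * n\<^sup>2" "n powr (2-p-2-2) = n powr (-p) / n\<^sup>2"
    using powr_add[of n "-p" 2] powr_diff[of n "-p" 2] n by (simp_all add: powr_realpow)
  have scaled: "x$i = n * s$i" "G x = G s" "pd G j x = pd G j s / n"
    "pd (pd G j) i x = pd (pd G j) i s / n\<^sup>2" for i j
    using G.homogeneous G.pd_G_scaleR G.pd_pd_G_scaleR n s xs by auto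
  have "pd (pd (homog_u p g) j) i x = n powr (-p) * Phi p g s $i$j" for i j
    unfolding u G.pd_pd_radial_mult[OF x] Phi_nth[OF s1] n_def[symmetric]
    unfolding powr scaled using n by (simp add: field_simps power2_eq_square)
  then show ?thesis
    by (simp add: vec_eq_iff hess_def s_def n_def)
qed

end

theorem proposition5p2:
  fixes p :: real and F :: "(real^'n^'n) set" and g :: "real^'n \<Rightarrow> real"
  assumes "cone_subequation F" and "C2_sphere g"
  shows "((\<forall>x. x \<noteq> 0 \<longrightarrow> hess (homog_u p g) x \<in> F)
            \<longleftrightarrow> (\<forall>s\<in>sphere 0 1. Phi p g s \<in> F))
       \<and> ((\<forall>x. x \<noteq> 0 \<longrightarrow> hess (homog_u p g) x \<in> bdry F)
            \<longleftrightarrow> (\<forall>s\<in>sphere 0 1. Phi p g s \<in> bdry F))"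
proof -
  have "t *\<^sub>R A \<in> F \<longleftrightarrow> A \<in> F" "t *\<^sub>R A \<in> bdry F \<longleftrightarrow> A \<in> bdry F" if "t > 0" for t A
    using assms(1) that unfolding cone_subequation_def
    by (auto intro!: scaleR_mem_iff_of_positively_closed bdry_scaleR[OF assms(1)])
  moreover have "norm x powr (-p) > 0" if "x \<noteq> 0" for x :: "real^'n"
    using that by simp
  ultimately show ?thesis
    using hess_homog_u[OF assms(2)]
    by (intro conjI all_nonzero_iff_all_sphere_if_scale_invariant) auto
qed

end
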